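(* Let $(R,\mathfrak m,k)$ be a local ring with Koszul complex $K=K^R$ on a minimal generating set of $\mathfrak m$, let $t\ge 2$ be an integer, and let $r\ge 1$ be an odd integer. Assume that condition $\mathcal P_{t,r}$ holds: there exists $[l]\in H_r(K)$, the class of a cycle $l\in K_r$, such that for every $z\in Z(\mathfrak m^tK)$ there exists $z'\in Z(\mathfrak m^{t-1}K)$ with $z-z'l\in B(\mathfrak m^{t-1}K)$. Let $\mathcal B=K\langle y\mid\partial(y)=l\rangle$. Then the map $$H_i(\mathfrak m^t\mathcal B)\to H_i(\mathfrak m^{t-1}\mathcal B)$$ induced by the inclusion $\mathfrak m^t\hookrightarrow\mathfrak m^{t-1}$ is zero for all $i\ge 0$.
   Context: Local rings are commutative Noetherian. $K$ is regarded as a graded-commutative DG algebra with differential $\partial$. For an integer $j$, $Z(\mathfrak m^jK)$ is the set of cycles of the subcomplex $\mathfrak m^jK\subseteq K$, and $B(\mathfrak m^jK)=\partial(\mathfrak m^jK)$ is its set of boundaries. Since $|l|=r$ is odd, $K\langle y\mid\partial(y)=l\rangle$ is the DG algebra obtained by adjoining a divided powers variable $y$ of degree $r+1$: as a graded $K$-module it is free with basis $\{y^{(i)}\}_{i\ge 0}$, $|y^{(i)}|=i(r+1)$, $y^{(0)}=1$, $y^{(1)}=y$, with multiplication determined by $y^{(i)}y^{(j)}=\binom{i+j}{i}y^{(i+j)}$ and differential $$\partial\Big(\sum_i b_iy^{(i)}\Big)=\sum_i\partial(b_i)y^{(i)}+\sum_i(-1)^{|b_i|}b_i\,l\,y^{(i-1)},\qquad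 b_i\in K,$$ where $y^{(-1)}=0$. $\mathfrak m^j\mathcal B$ denotes the corresponding subcomplex of $\mathcal B$. *)

theory Defs
  imports Complex_Main "HOL-Library.Poly_Mapping"
begin

section \<open>Ideals and local rings\<close>

text \<open>The ring \<open>R\<close> is a type of class \<open>comm_ring_1\<close>.  Its ideals are its submodules, in the
  sense of the library locale \<open>module\<close> with scalar multiplication \<open>(*)\<close>.\<close>

lemma module_times: "module ((*) :: 'a::comm_ring_1 \<Rightarrow> 'a \<Rightarrow> 'a)"
  by unfold_locales (simp_all add: algebra_simps)

abbreviation is_ideal :: "'a::comm_ring_1 set \<Rightarrow> bool"
  where "is_ideal \<equiv> module.subspace (*)"

abbreviation ideal_gen :: "'a::comm_ring_1 set \<Rightarrow> 'a set"
  where "ideal_gen \<equiv> module.span (*)"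

definition is_maximal_ideal :: "'a::comm_ring_1 set \<Rightarrow> bool"
  where "is_maximal_ideal I \<longleftrightarrow>
    is_ideal I \<and> I \<noteq> UNIV \<and> (\<forall>J. is_ideal J \<and> I \<subseteq> J \<longrightarrow> J = I \<or> J = UNIV)"

definition noetherian_local_ring :: "'a::comm_ring_1 set \<Rightarrow> bool"
  where "noetherian_local_ring \<mm> \<longleftrightarrow>
    (\<forall>I :: 'a set. is_ideal I \<longrightarrow> (\<exists>F. finite F \<and> ideal_gen F = I)) \<and>
    is_maximal_ideal \<mm> \<and> (\<forall>\<nn>. is_maximal_ideal \<nn> \<longrightarrow> \<nn> = \<mm>)"

definition minimal_generators :: "'a::comm_ring_1 list \<Rightarrow> 'a set \<Rightarrow> bool"
  where "minimal_generators xs I \<longleftrightarrow>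
    distinct xs \<and> ideal_gen (set xs) = I \<and> (\<forall>Y. Y \<subset> set xs \<longrightarrow> ideal_gen Y \<noteq> I)"

text \<open>\<open>ideal_mult s I M\<close> is the submodule \<open>I M\<close>, for scalar multiplication \<open>s\<close>.\<close>

definition ideal_mult ::
    "('a::comm_ring_1 \<Rightarrow> 'm::ab_group_add \<Rightarrow> 'm) \<Rightarrow> 'a set \<Rightarrow> 'm set \<Rightarrow> 'm set"
  where "ideal_mult s I M = module.span s {s a v |a v. a \<in> I \<and> v \<in> M}"

definition ideal_power :: "'a::comm_ring_1 set \<Rightarrow> nat \<Rightarrow> 'a set"
  where "ideal_power I j = (ideal_mult (*) I ^^ j) UNIV"


section \<open>Homology\<close>

text \<open>A complex is given by its graded pieces \<open>C :: nat \<Rightarrow> 'c set\<close>, subgroups of an ambient abelian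
  group, and a differential \<open>d\<close> mapping \<open>C (Suc i)\<close> to \<open>C i\<close> and \<open>C 0\<close> to \<open>0\<close>.  Homology is the
  quotient of the cycles by the congruence modulo boundaries; its elements are classes.\<close>

definition cycles_deg :: "(nat \<Rightarrow> 'c::ab_group_add set) \<Rightarrow> ('c \<Rightarrow> 'c) \<Rightarrow> nat \<Rightarrow> 'c set"
  where "cycles_deg C d i = {z \<in> C i. d z = 0}"

definition homologous :: "(nat \<Rightarrow> 'c::ab_group_add set) \<Rightarrow> ('c \<Rightarrow> 'c) \<Rightarrow> nat \<Rightarrow> ('c \<times> 'c) set"
  where "homologous C d i =
    {(z, z'). z \<in> cycles_deg C d i \<and> z' \<in> cycles_deg C d i \<and> z - z' \<in> d ` C (Suc i)}"

definition homology :: "(nat \<Rightarrow> 'c::ab_group_add set) \<Rightarrow> ('c \<Rightarrow> 'c) \<Rightarrow> nat \<Rightarrow> 'c set set"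
  where "homology C d i = cycles_deg C d i // homologous C d i"

definition homology_zero :: "(nat \<Rightarrow> 'c::ab_group_add set) \<Rightarrow> ('c \<Rightarrow> 'c) \<Rightarrow> nat \<Rightarrow> 'c set"
  where "homology_zero C d i = homologous C d i `` {0}"

text \<open>The map \<open>[z] \<mapsto> [f z]\<close> into the homology of \<open>(D, d)\<close>, for a chain map \<open>f\<close> into \<open>D\<close>.\<close>

definition homology_map ::
    "('c \<Rightarrow> 'e) \<Rightarrow> (nat \<Rightarrow> 'e::ab_group_add set) \<Rightarrow> ('e \<Rightarrow> 'e) \<Rightarrow> nat \<Rightarrow> 'c set \<Rightarrow> 'e set"
  where "homology_map f D d i X = (\<Union>z\<in>X. homologous D d i `` {f z})"


section \<open>The Koszul complex\<close>

text \<open>The Koszul complex on \<open>xs = [x\<^sub>0, \<dots>, x\<^sub>n\<^sub>-\<^sub>1]\<close> is the exterior algebra on \<open>e\<^sub>0, \<dots>, e\<^sub>n\<^sub>-\<^sub>1\<close>, free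
  on the products \<open>e\<^sub>S\<close> (increasing order) for \<open>S \<subseteq> {..<n}\<close>, with \<open>\<partial> e\<^sub>i = x\<^sub>i\<close>.  An element is the
  finitely supported function of its coefficients.\<close>

type_synonym 'a koszul = "nat set \<Rightarrow>\<^sub>0 'a"

definition koszul :: "'a::comm_ring_1 list \<Rightarrow> 'a koszul set"
  where "koszul xs = {v. \<forall>S\<in>Poly_Mapping.keys v. S \<subseteq> {..<length xs}}"

definition koszul_deg :: "'a::comm_ring_1 list \<Rightarrow> nat \<Rightarrow> 'a koszul set"
  where "koszul_deg xs i =
    {v. \<forall>S\<in>Poly_Mapping.keys v. S \<subseteq> {..<length xs} \<and> card S = i}"

definition kscale :: "'a::comm_ring_1 \<Rightarrow> 'a koszul \<Rightarrow> 'a koszul"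
  where "kscale a v = Poly_Mapping.map ((*) a) v"

lemma lookup_kscale: "Poly_Mapping.lookup (kscale a v) S = a * Poly_Mapping.lookup v S"
  by (simp add: kscale_def Poly_Mapping.map.rep_eq when_def)

lemma module_kscale: "module (kscale :: 'a::comm_ring_1 \<Rightarrow> _)"
  by unfold_locales
    (auto intro!: poly_mapping_eqI simp: lookup_kscale lookup_add algebra_simps)

text \<open>\<open>e\<^sub>S e\<^sub>T = \<plusminus> e\<^sub>S\<^sub>\<union>\<^sub>T\<close> if \<open>S\<close> and \<open>T\<close> are disjoint, the sign being that of the sorting permutation,
  and \<open>e\<^sub>S e\<^sub>T = 0\<close> otherwise.\<close>

definition kmult :: "'a::comm_ring_1 koszul \<Rightarrow> 'a koszul \<Rightarrow> 'a koszul"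
  where "kmult u v = (\<Sum>S\<in>Poly_Mapping.keys u. \<Sum>T\<in>Poly_Mapping.keys v.
    if S \<inter> T = {}
    then Poly_Mapping.single (S \<union> T)
      ((-1) ^ card {(s, t). s \<in> S \<and> t \<in> T \<and> t < s}
        * Poly_Mapping.lookup u S * Poly_Mapping.lookup v T)
    else 0)"

definition kdiff :: "'a::comm_ring_1 list \<Rightarrow> 'a koszul \<Rightarrow> 'a koszul"
  where "kdiff xs v = (\<Sum>S\<in>Poly_Mapping.keys v. \<Sum>s\<in>S.
    Poly_Mapping.single (S - {s})
      ((-1) ^ card {t \<in> S. t < s} * Poly_Mapping.lookup v S * xs ! s))"

text \<open>The linear extension of \<open>b \<mapsto> (-1)\<^bsup>|b|\<^esup> b\<close> from homogeneous to arbitrary elements.\<close>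

definition ktwist :: "'a::comm_ring_1 koszul \<Rightarrow> 'a koszul"
  where "ktwist v = (\<Sum>S\<in>Poly_Mapping.keys v.
    Poly_Mapping.single S ((-1) ^ card S * Poly_Mapping.lookup v S))"

text \<open>\<open>\<mm>\<^sup>j K\<close> with its cycles and boundaries; elements need not be homogeneous.\<close>

definition mK :: "'a::comm_ring_1 list \<Rightarrow> 'a set \<Rightarrow> nat \<Rightarrow> 'a koszul set"
  where "mK xs \<mm> j = ideal_mult kscale (ideal_power \<mm> j) (koszul xs)"

definition mK_cycles :: "'a::comm_ring_1 list \<Rightarrow> 'a set \<Rightarrow> nat \<Rightarrow> 'a koszul set"
  where "mK_cycles xs \<mm> j = {z \<in> mK xs \<mm> j. kdiff xs z = 0}"

definition mK_boundaries :: "'a::comm_ring_1 list \<Rightarrow> 'a set \<Rightarrow> nat \<Rightarrow> 'a koszul set"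
  where "mK_boundaries xs \<mm> j = kdiff xs ` mK xs \<mm> j"

text \<open>\<open>condition_P xs \<mm> t r l\<close>: condition \<open>P\<^bsub>t,r\<^esub>\<close> holds, witnessed by the class of the cycle \<open>l\<close>.\<close>

definition condition_P :: "'a::comm_ring_1 list \<Rightarrow> 'a set \<Rightarrow> nat \<Rightarrow> nat \<Rightarrow> 'a koszul \<Rightarrow> bool"
  where "condition_P xs \<mm> t r l \<longleftrightarrow>
    l \<in> cycles_deg (koszul_deg xs) (kdiff xs) r \<and>
    (\<forall>z \<in> mK_cycles xs \<mm> t. \<exists>z' \<in> mK_cycles xs \<mm> (t - 1).
      z - kmult z' l \<in> mK_boundaries xs \<mm> (t - 1))"


section \<open>Adjoining a divided powers variable\<close>

text \<open>An element \<open>\<Sum>\<^sub>i b\<^sub>i y\<^bsup>(i)\<^esup>\<close> of \<open>K\<langle>y | \<partial> y = l\<rangle>\<close> is the finitely supported function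
  \<open>i \<mapsto> b\<^sub>i\<close>, where \<open>y\<^bsup>(i)\<^esup>\<close> has degree \<open>i (r + 1)\<close> for \<open>l\<close> of degree \<open>r\<close>.  Only the underlying
  complex of \<open>R\<close>-modules enters its homology and that of its subcomplexes, so the product
  \<open>y\<^bsup>(i)\<^esup> y\<^bsup>(j)\<^esup>\<close> is not introduced.\<close>

type_synonym 'a divpow = "nat \<Rightarrow>\<^sub>0 'a koszul"

definition divpow :: "'a::comm_ring_1 list \<Rightarrow> 'a divpow set"
  where "divpow xs = {w. \<forall>i. Poly_Mapping.lookup w i \<in> koszul xs}"

definition divpow_deg :: "'a::comm_ring_1 list \<Rightarrow> nat \<Rightarrow> nat \<Rightarrow> 'a divpow set"
  where "divpow_deg xs r p = {w. \<forall>i\<in>Poly_Mapping.keys w.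
    i * (r + 1) \<le> p \<and> Poly_Mapping.lookup w i \<in> koszul_deg xs (p - i * (r + 1))}"

definition dscale :: "'a::comm_ring_1 \<Rightarrow> 'a divpow \<Rightarrow> 'a divpow"
  where "dscale a w = Poly_Mapping.map (kscale a) w"

lemma lookup_dscale:
  "Poly_Mapping.lookup (dscale a w) i = kscale a (Poly_Mapping.lookup w i)"
  by (simp add: dscale_def Poly_Mapping.map.rep_eq when_def module.scale_zero_right[OF module_kscale])

lemma module_dscale: "module (dscale :: 'a::comm_ring_1 \<Rightarrow> _)"
  by unfold_locales
    (auto intro!: poly_mapping_eqI
      simp: lookup_dscale lookup_kscale lookup_add algebra_simps)

definition ddiff :: "'a::comm_ring_1 list \<Rightarrow> 'a koszul \<Rightarrow> 'a divpow \<Rightarrow> 'a divpow"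
  where "ddiff xs l w = (\<Sum>i\<in>Poly_Mapping.keys w.
    Poly_Mapping.single i (kdiff xs (Poly_Mapping.lookup w i)) +
    (if i = 0 then 0
     else Poly_Mapping.single (i - 1) (kmult (ktwist (Poly_Mapping.lookup w i)) l)))"

definition mB_deg :: "'a::comm_ring_1 list \<Rightarrow> 'a set \<Rightarrow> nat \<Rightarrow> nat \<Rightarrow> nat \<Rightarrow> 'a divpow set"
  where "mB_deg xs \<mm> r j p =
    ideal_mult dscale (ideal_power \<mm> j) (divpow xs) \<inter> divpow_deg xs r p"

end

theory Submission
  imports Defs
begin

text \<open>
  Let \<open>w = \<Sum>\<^sub>i b\<^sub>i y\<^bsup>(i)\<^esup>\<close> with \<open>i \<le> n\<close> be a cycle of \<open>\<mm>\<^sup>t\<B>\<close>.  The top coefficient \<open>b\<^sub>n\<close> is a cycle of \<open>\<mm>\<^sup>tK\<close>, so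
  \<open>b\<^sub>n = z l + \<partial> c\<close> with \<open>z\<close>, \<open>c\<close> in \<open>\<mm>\<^bsup>t-1\<^esup>K\<close> and \<open>\<partial> z = 0\<close>.  The boundary of \<open>u = \<plusminus> z y\<^bsup>(n+1)\<^esup> + c y\<^bsup>(n)\<^esup>\<close> has
  top coefficient \<open>b\<^sub>n\<close>, and its only other coefficient is \<open>\<plusminus> c l\<close>, in position \<open>n - 1\<close>.  As the
  generators are minimal and \<open>|l| > 0\<close>, the cycle \<open>l\<close> lies in \<open>\<mm>K\<close>, whence \<open>c l \<in> \<mm>\<^sup>tK\<close>; so \<open>w - \<partial> u\<close> is
  a cycle of \<open>\<mm>\<^sup>t\<B>\<close> with fewer coefficients, and induction on \<open>n\<close> makes \<open>w\<close> a boundary in \<open>\<mm>\<^bsup>t-1\<^esup>\<B>\<close>.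
\<close>

abbreviation coeff :: "('i \<Rightarrow>\<^sub>0 'b::zero) \<Rightarrow> 'i \<Rightarrow> 'b"
  where "coeff \<equiv> Poly_Mapping.lookup"

abbreviation supp :: "('i \<Rightarrow>\<^sub>0 'b::zero) \<Rightarrow> 'i set"
  where "supp \<equiv> Poly_Mapping.keys"

section \<open>Additive maps on finitely supported functions\<close>

lemma additive_compose:
  assumes "additive f" "additive g"
  shows "additive (\<lambda>v. f (g v))"
  using assms by (simp add: additive_def)

lemma additive_add_fun:
  assumes "additive f" "additive g"
  shows "additive (\<lambda>v. f v + g v)"
  using assms by (simp add: additive_def)

lemma additive_uminus_fun:
  assumes "additive f"
  shows "additive (\<lambda>v. - f v)"
  using assms by (simp add: additive_def)

lemma additive_sum_fun:
  assumes "\<And>T. T \<in> B \<Longrightarrow> additive (F T)"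
  shows "additive (\<lambda>v. \<Sum>T\<in>B. F T v)"
  using assms by (simp add: additive_def sum.distrib)

lemma sum_supp_superset:
  assumes "\<And>S. F S 0 = 0" "finite A" "supp v \<subseteq> A"
  shows "(\<Sum>S\<in>supp v. F S (coeff v S)) = (\<Sum>S\<in>A. F S (coeff v S))"
  using assms by (intro sum.mono_neutral_left) (auto simp: in_keys_iff)

text \<open>The range of summation depends on the argument; moving all sums to the common superset
  \<open>supp u \<union> supp v\<close> makes additivity termwise. Additivity of products,
  differentials and twists follows from this.\<close>

lemma additive_sum_supp:
  fixes F :: "'i \<Rightarrow> 'b::ab_group_add \<Rightarrow> 'c::ab_group_add"
  assumes "\<And>S. additive (F S)"
  shows "additive (\<lambda>v. \<Sum>S\<in>supp v. F S (coeff v S))"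
proof
  fix u v :: "'i \<Rightarrow>\<^sub>0 'b"
  let ?A = "supp u \<union> supp v"
  have F0: "F S 0 = 0" for S using additive.zero[OF assms] .
  have "(\<Sum>S\<in>supp (u + v). F S (coeff (u + v) S)) = (\<Sum>S\<in>?A. F S (coeff (u + v) S))"
    by (intro sum_supp_superset F0) (auto simp: keys_add)
  also have "\<dots> = (\<Sum>S\<in>?A. F S (coeff u S)) + (\<Sum>S\<in>?A. F S (coeff v S))"
    by (simp add: lookup_add additive.add[OF assms] sum.distrib)
  also have "\<dots> = (\<Sum>S\<in>supp u. F S (coeff u S)) + (\<Sum>S\<in>supp v. F S (coeff v S))"
    by (intro arg_cong2[of _ _ _ _ "(+)"] sum_supp_superset[of F, OF F0, symmetric]) auto
  finally show "(\<Sum>S\<in>supp (u + v). F S (coeff (u + v) S)) = \<dots>" .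
qed

lemma sum_single_coeff: "(\<Sum>S\<in>supp v. Poly_Mapping.single S (coeff v S)) = v"
  by (rule poly_mapping_eqI) (auto simp: lookup_sum lookup_single when_def in_keys_iff)

text \<open>Every element is the sum of its monomials. Restricting to keys in \<open>supp v\<close>
  makes hypotheses on \<open>v\<close>, such as finiteness of its index sets, available for each
  monomial.\<close>

lemma additive_eqI:
  fixes f g :: "('i \<Rightarrow>\<^sub>0 'b::ab_group_add) \<Rightarrow> 'c::ab_group_add"
  assumes "additive f" "additive g"
    and "\<And>S. S \<in> supp v \<Longrightarrow>
      f (Poly_Mapping.single S (coeff v S)) = g (Poly_Mapping.single S (coeff v S))"
  shows "f v = g v"
proof -
  have "f v = (\<Sum>S\<in>supp v. f (Poly_Mapping.single S (coeff v S)))"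
    using additive.sum[OF assms(1)] sum_single_coeff[of v] by metis
  also have "\<dots> = (\<Sum>S\<in>supp v. g (Poly_Mapping.single S (coeff v S)))"
    using assms(3) by simp
  also have "\<dots> = g v"
    using additive.sum[OF assms(2)] sum_single_coeff[of v] by metis
  finally show ?thesis .
qed

lemma additive_single: "additive (Poly_Mapping.single S :: 'b::ab_group_add \<Rightarrow> _)"
  by standard (rule single_add)

section \<open>The exterior algebra\<close>

definition ksign :: "nat set \<Rightarrow> nat set \<Rightarrow> 'a::comm_ring_1"
  where "ksign S T = (-1) ^ card {(s, t). s \<in> S \<and> t \<in> T \<and> t < s}"

lemma finite_inversions:
  "finite S \<Longrightarrow> finite T \<Longrightarrow> finite {(s, t). s \<in> S \<and> t \<in> T \<and> (t::nat) < s}"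
  by (rule finite_subset[of _ "S \<times> T"]) auto

lemma ksign_Un_left:
  assumes "finite S" "finite S'" "finite T" "S \<inter> S' = {}"
  shows "ksign (S \<union> S') T = ksign S T * ksign S' T"
proof -
  have "{(s, t). s \<in> S \<union> S' \<and> t \<in> T \<and> t < s} =
    {(s, t). s \<in> S \<and> t \<in> T \<and> t < s} \<union> {(s, t). s \<in> S' \<and> t \<in> T \<and> t < s}" by auto
  then show ?thesis
    unfolding ksign_def power_add[symmetric]
    using assms by (subst card_Un_disjoint[symmetric]) (auto intro: finite_inversions)
qed

lemma ksign_Un_right:
  assumes "finite S" "finite T" "finite T'" "T \<inter> T' = {}"
  shows "ksign S (T \<union> T') = ksign S T * ksign S T'"
proof -
  have "{(s, t). s \<in> S \<and> t \<in> T \<union> T' \<and> t < s} =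
    {(s, t). s \<in> S \<and> t \<in> T \<and> t < s} \<union> {(s, t). s \<in> S \<and> t \<in> T' \<and> t < s}" by auto
  then show ?thesis
    unfolding ksign_def power_add[symmetric]
    using assms by (subst card_Un_disjoint[symmetric]) (auto intro: finite_inversions)
qed

text \<open>As the sets are disjoint, each pair in \<open>S \<times> T\<close> is an inversion for
  exactly one of the two orders, so the two inversion counts add up to
  \<open>card S * card T\<close>.\<close>

lemma ksign_swap:
  assumes "finite S" "finite T" "S \<inter> T = {}"
  shows "ksign S T * ksign T S = (-1) ^ (card S * card T)"
proof -
  have "card {(s, t). s \<in> T \<and> t \<in> S \<and> t < s} = card {(s, t). s \<in> S \<and> t \<in> T \<and> s < t}"
    by (rule bij_betw_same_card[of prod.swap]) (auto simp: bij_betw_def inj_on_def image_iff)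
  moreover have "S \<times> T =
    {(s, t). s \<in> S \<and> t \<in> T \<and> t < s} \<union> {(s, t). s \<in> S \<and> t \<in> T \<and> s < t}"
    using assms by auto
  moreover have "finite {(s, t). s \<in> S \<and> t \<in> T \<and> s < t}"
    using assms by - (rule finite_subset[of _ "S \<times> T"], auto)
  ultimately have "card (S \<times> T) = card {(s, t). s \<in> S \<and> t \<in> T \<and> t < s}
      + card {(s, t). s \<in> T \<and> t \<in> S \<and> t < s}"
    using assms by (simp add: card_Un_disjoint[OF finite_inversions] disjoint_iff)
  then show ?thesis by (simp add: ksign_def power_add[symmetric] card_cartesian_product)
qed

lemma ksign_square [simp]: "ksign S T * ksign S T = 1"
  by (simp add: ksign_def power_add[symmetric] flip: mult_2)

text \<open>The sign in the Koszul differential is itself an exterior sign, that of splitting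
  \<open>s\<close> off to the left. Product and differential thus obey the same sign rules.\<close>

lemma ksign_singleton: "ksign {s} (S - {s}) = (-1) ^ card {t \<in> S. t < s}"
proof -
  have "card {(s', t). s' \<in> {s} \<and> t \<in> S - {s} \<and> t < s'} = card {t \<in> S. t < s}"
    by (rule bij_betw_same_card[of snd]) (force simp: bij_betw_def inj_on_def image_iff)
  then show ?thesis by (simp add: ksign_def)
qed

section \<open>Product, differential and twist, and the identities between them\<close>

lemma kmult_alt: "kmult u v = (\<Sum>S\<in>supp u. \<Sum>T\<in>supp v. if S \<inter> T = {}
    then Poly_Mapping.single (S \<union> T) (ksign S T * coeff u S * coeff v T) else 0)"
  unfolding kmult_def ksign_def ..

lemma kdiff_alt: "kdiff xs v = (\<Sum>S\<in>supp v. \<Sum>s\<in>S.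
    Poly_Mapping.single (S - {s}) (ksign {s} (S - {s}) * coeff v S * xs ! s))"
  by (simp add: kdiff_def ksign_singleton)

lemma additive_kmult_left: "additive (\<lambda>u. kmult u v)"
  unfolding kmult_alt
  by (rule additive_sum_supp[of "\<lambda>S a. \<Sum>T\<in>supp v. if S \<inter> T = {}
    then Poly_Mapping.single (S \<union> T) (ksign S T * a * coeff v T) else 0"])
    (auto intro!: additive.intro simp: algebra_simps single_add simp flip: sum.distrib
      intro!: sum.cong)

lemma additive_kmult_right: "additive (\<lambda>v. kmult u v)"
  unfolding kmult_alt
  by (rule additive_sum_fun) (rule additive_sum_supp[of "\<lambda>T b. if S \<inter> T = {}
    then Poly_Mapping.single (S \<union> T) (ksign S T * coeff u S * b) else 0" for S];
    auto intro!: additive.intro simp: algebra_simps single_add)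

lemma additive_kdiff: "additive (kdiff xs)"
  unfolding kdiff_alt
  by (rule additive_sum_supp[of "\<lambda>S a. \<Sum>s\<in>S.
    Poly_Mapping.single (S - {s}) (ksign {s} (S - {s}) * a * xs ! s)"])
    (auto intro!: additive.intro simp: algebra_simps single_add simp flip: sum.distrib)

lemma additive_ktwist: "additive ktwist"
  unfolding ktwist_def
  by (rule additive_sum_supp[of "\<lambda>S a. Poly_Mapping.single S ((-1) ^ card S * a)"])
    (auto intro!: additive.intro simp: algebra_simps single_add)

lemma kmult_single:
  "kmult (Poly_Mapping.single S a) (Poly_Mapping.single T b) =
    (if S \<inter> T = {} then Poly_Mapping.single (S \<union> T) (ksign S T * a * b) else 0)"
  by (simp add: kmult_alt)

lemma kdiff_single:
  "kdiff xs (Poly_Mapping.single S a) =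
    (\<Sum>s\<in>S. Poly_Mapping.single (S - {s}) (ksign {s} (S - {s}) * a * xs ! s))"
  by (simp add: kdiff_alt)

lemma coeff_ktwist: "coeff (ktwist v) S = (-1) ^ card S * coeff v S"
  by (auto simp: ktwist_def lookup_sum lookup_single when_def in_keys_iff)

lemma ktwist_single:
  "ktwist (Poly_Mapping.single S a) = Poly_Mapping.single S ((-1) ^ card S * a)"
  by (simp add: ktwist_def)

lemma ktwist_ktwist [simp]: "ktwist (ktwist v) = v"
  by (rule poly_mapping_eqI) (simp add: coeff_ktwist mult.assoc[symmetric] power_add[symmetric] flip: mult_2)

lemma supp_ktwist [simp]: "supp (ktwist v) = supp v"
  by (auto simp: in_keys_iff coeff_ktwist)
    (metis mult_zero_right coeff_ktwist ktwist_ktwist)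

text \<open>The type of Koszul elements admits infinite index sets, whose \<open>card\<close> is 0,
  while the sign rules concern finite sets. Elements of the Koszul complex itself all lie in
  \<open>kfin\<close>.\<close>

definition kfin :: "'a::comm_ring_1 koszul set"
  where "kfin = {v. \<forall>S\<in>supp v. finite S}"

lemma kmult_eqI:
  assumes "\<And>u. additive (\<lambda>v. f u v)" "\<And>v. additive (\<lambda>u. f u v)"
    and "\<And>u. additive (\<lambda>v. g u v)" "\<And>v. additive (\<lambda>u. g u v)"
    and "u \<in> kfin" "v \<in> kfin"
    and "\<And>S T a b. finite S \<Longrightarrow> finite T \<Longrightarrow> f (Poly_Mapping.single S a) (Poly_Mapping.single T b) =
      g (Poly_Mapping.single S a) (Poly_Mapping.single T b)"
  shows "f u v = g u v"
  by (rule additive_eqI[of "\<lambda>u. f u v" "\<lambda>u. g u v"], rule assms, rule assms,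
      rule additive_eqI[of "\<lambda>v. f _ v" "\<lambda>v. g _ v"], rule assms, rule assms, rule assms(7))
    (use assms(5,6) in \<open>auto simp: kfin_def\<close>)

text \<open>On monomials both sides carry the product of the signs of the three pairs among
  \<open>S\<close>, \<open>T\<close>, \<open>U\<close>, and both vanish if two of these sets
  meet.\<close>

lemma kmult_assoc:
  assumes "u \<in> kfin" "v \<in> kfin" "w \<in> kfin"
  shows "kmult (kmult u v) w = kmult u (kmult v w)"
proof (rule kmult_eqI[OF _ _ _ _ assms(1,2), of "\<lambda>u v. kmult (kmult u v) w" "\<lambda>u v. kmult u (kmult v w)"])
  fix S T :: "nat set" and a b :: 'a
  assume fin: "finite S" "finite T"
  show "kmult (kmult (Poly_Mapping.single S a) (Poly_Mapping.single T b)) w =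
    kmult (Poly_Mapping.single S a) (kmult (Poly_Mapping.single T b) w)"
  proof (rule additive_eqI[of "kmult (kmult (Poly_Mapping.single S a) (Poly_Mapping.single T b))"
        "\<lambda>w. kmult (Poly_Mapping.single S a) (kmult (Poly_Mapping.single T b) w)" w])
    fix U assume "U \<in> supp w"
    then have "finite U" using assms by (auto simp: kfin_def)
    then show "kmult (kmult (Poly_Mapping.single S a) (Poly_Mapping.single T b))
        (Poly_Mapping.single U (coeff w U)) =
      kmult (Poly_Mapping.single S a)
        (kmult (Poly_Mapping.single T b) (Poly_Mapping.single U (coeff w U)))"
      using fin by (auto simp: kmult_single additive.zero[OF additive_kmult_left]
        additive.zero[OF additive_kmult_right] Int_Un_distrib Int_Un_distrib2 Un_assoc
        ksign_Un_left ksign_Un_right algebra_simps)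
  qed (intro additive_kmult_right additive_compose[OF additive_kmult_right])+
qed (intro additive_kmult_right additive_kmult_left additive_compose[OF additive_kmult_right]
    additive_compose[OF additive_kmult_left])+

text \<open>Cardinalities add on disjoint unions, so the twist is multiplicative.\<close>

lemma ktwist_kmult:
  assumes "u \<in> kfin" "v \<in> kfin"
  shows "ktwist (kmult u v) = kmult (ktwist u) (ktwist v)"
  by (rule kmult_eqI[OF _ _ _ _ assms]; (intro additive_kmult_right additive_kmult_left
     additive_compose[OF additive_kmult_right] additive_compose[OF additive_kmult_left]
     additive_compose[OF additive_ktwist] additive_ktwist)?)
    (auto simp: ktwist_single kmult_single card_Un_disjoint power_add additive.zero[OF additive_ktwist]
      algebra_simps)

text \<open>The differential removes one element from each index set, which flips the parity of its
  cardinality.\<close>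

lemma kdiff_ktwist:
  assumes "v \<in> kfin"
  shows "kdiff xs (ktwist v) = - ktwist (kdiff xs v)"
proof (rule additive_eqI[of "\<lambda>v. kdiff xs (ktwist v)" "\<lambda>v. - ktwist (kdiff xs v)"])
  fix S assume "S \<in> supp v"
  then have "finite S" using assms by (auto simp: kfin_def)
  moreover have "(-1) ^ card S = - ((-1) ^ card (S - {s}) :: 'a)" if "s \<in> S" for s
    using that \<open>finite S\<close> by (metis card_Suc_Diff1 power_Suc mult_minus1)
  ultimately show "kdiff xs (ktwist (Poly_Mapping.single S (coeff v S))) =
      - ktwist (kdiff xs (Poly_Mapping.single S (coeff v S)))"
    by (simp add: kdiff_single ktwist_single additive.sum[OF additive_ktwist] sum_negf[symmetric]
      single_uminus[symmetric] algebra_simps)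
qed (intro additive_compose[OF additive_kdiff] additive_uminus_fun additive_compose[OF additive_ktwist]
  additive_ktwist additive_kdiff)+

lemma ksign_remove_left:
  assumes "finite S" "finite T" "s \<in> S"
  shows "ksign S T = ksign {s} T * ksign (S - {s}) T"
  using ksign_Un_left[of "{s}" "S - {s}" T] assms by (simp add: insert_absorb)

lemma ksign_remove_right:
  assumes "finite S" "finite T" "t \<in> T"
  shows "ksign S T = ksign S {t} * ksign S (T - {t})"
  using ksign_Un_right[of S "{t}" "T - {t}"] assms by (simp add: insert_absorb)

lemma ksign_mult_square [simp]: "ksign S T * (ksign S T * a) = a"
  by (simp add: mult.assoc[symmetric])

text \<open>The graded Leibniz rule on monomials. For disjoint \<open>S\<close> and \<open>T\<close>
  the elements deleted from \<open>S\<close> give the first summand and those deleted from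
  \<open>T\<close> the second. If the sets meet, the left side is zero and the right side
  cancels.\<close>

lemma kdiff_kmult_single:
  assumes fin: "finite S" "finite T"
  shows "kdiff xs (kmult (Poly_Mapping.single S a) (Poly_Mapping.single T b)) =
    kmult (kdiff xs (Poly_Mapping.single S a)) (Poly_Mapping.single T b) +
    kmult (ktwist (Poly_Mapping.single S a)) (kdiff xs (Poly_Mapping.single T b))"
proof -
  define L where "L s = (if (S - {s}) \<inter> T = {} then Poly_Mapping.single ((S - {s}) \<union> T)
    (ksign (S - {s}) T * (ksign {s} (S - {s}) * a * xs ! s) * b) else 0)" for s
  define R where "R t = (if S \<inter> (T - {t}) = {} then Poly_Mapping.single (S \<union> (T - {t}))
    (ksign S (T - {t}) * ((-1) ^ card S * a) * (ksign {t} (T - {t}) * b * xs ! t)) else 0)" for t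
  have L: "kmult (kdiff xs (Poly_Mapping.single S a)) (Poly_Mapping.single T b) = sum L S"
    unfolding kdiff_single additive.sum[OF additive_kmult_left] kmult_single L_def ..
  have R: "kmult (ktwist (Poly_Mapping.single S a)) (kdiff xs (Poly_Mapping.single T b)) = sum R T"
    unfolding kdiff_single ktwist_single additive.sum[OF additive_kmult_right] kmult_single R_def ..
  show ?thesis
  proof (cases "S \<inter> T = {}")
    case True
    \<comment> \<open>The factor \<open>ksign {s} T\<close> arises once from each of the two signs
      on the left and squares to 1.\<close>
    have Ls: "Poly_Mapping.single (S \<union> T - {s})
        (ksign {s} (S \<union> T - {s}) * (ksign S T * a * b) * xs ! s) = L s" if "s \<in> S" for s
    proof -
      have *: "S \<union> T - {s} = (S - {s}) \<union> T" "(S - {s}) \<inter> T = {}" using True that by auto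
      have "ksign {s} (S \<union> T - {s}) * ksign S T = (ksign (S - {s}) T * ksign {s} (S - {s}) :: 'a)"
        unfolding * using * fin that
        by (simp add: ksign_Un_right ksign_remove_left[OF fin that] algebra_simps)
      then have "ksign {s} (S \<union> T - {s}) * ksign S T * (a * b * xs ! s) =
          ksign (S - {s}) T * ksign {s} (S - {s}) * (a * b * xs ! s)" by simp
      then show ?thesis using * by (simp add: L_def algebra_simps)
    qed
    \<comment> \<open>Here \<open>ksign S {t}\<close> meets \<open>ksign {t} S\<close>; their
      product is the sign of moving \<open>t\<close> past \<open>S\<close>, which is the twist on
      the first factor.\<close>
    have Rt: "Poly_Mapping.single (S \<union> T - {t})
        (ksign {t} (S \<union> T - {t}) * (ksign S T * a * b) * xs ! t) = R t" if "t \<in> T" for t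
    proof -
      have *: "S \<union> T - {t} = S \<union> (T - {t})" "S \<inter> (T - {t}) = {}" "S \<inter> {t} = {}"
        using True that by auto
      have "ksign {t} (S \<union> T - {t}) * ksign S T =
          (ksign S (T - {t}) * ksign {t} (T - {t}) * (ksign S {t} * ksign {t} S) :: 'a)"
        unfolding * using * fin that
        by (simp add: ksign_Un_right ksign_remove_right[OF fin that] algebra_simps)
      also have "ksign S {t} * ksign {t} S = ((-1) ^ card S :: 'a)"
        using ksign_swap[of S "{t}"] * fin by simp
      finally have "ksign {t} (S \<union> T - {t}) * ksign S T * (a * b * xs ! t) =
          (ksign S (T - {t}) * ksign {t} (T - {t}) * (-1) ^ card S) * (a * b * xs ! t)" by simp
      then show ?thesis using * by (simp add: R_def algebra_simps)
    qed
    show ?thesis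
      unfolding L R using True fin Ls Rt
      by (simp add: kmult_single kdiff_single sum.union_disjoint)
  next
    case False
    then obtain u where u: "u \<in> S" "u \<in> T" by auto
    \<comment> \<open>Deleting the common element \<open>u\<close> from either factor leaves the
      same union with opposite signs. If the sets share a further element, both terms are
      zero.\<close>
    have LR: "L u + R u = 0"
    proof (cases "(S - {u}) \<inter> T = {}")
      case True
      then have *: "S \<inter> (T - {u}) = {}" "(S - {u}) \<union> T = S \<union> (T - {u})"
        using u by auto
      have card: "(-1) ^ card S = - ((-1) ^ card (S - {u}) :: 'a)"
        using u fin by (metis card_Suc_Diff1 power_Suc mult_minus1)
      have swap: "ksign (S - {u}) {u} * ksign {u} (S - {u}) = ((-1) ^ card (S - {u}) :: 'a)"
        using ksign_swap[of "S - {u}" "{u}"] fin by simp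
      have "ksign (S - {u}) T * ksign {u} (S - {u}) =
          (ksign (S - {u}) (T - {u}) * (-1) ^ card (S - {u}) :: 'a)"
        unfolding swap[symmetric] ksign_remove_right[OF finite_Diff[OF fin(1)] fin(2) u(2), of "{u}"]
        by (simp add: algebra_simps)
      moreover have "ksign S (T - {u}) * (-1) ^ card S * ksign {u} (T - {u}) =
          - (ksign (S - {u}) (T - {u}) * (-1) ^ card (S - {u}) :: 'a)"
        unfolding card ksign_remove_left[OF fin(1) finite_Diff[OF fin(2)] u(1), of "{u}"]
        by (simp add: algebra_simps)
      ultimately have "(ksign (S - {u}) T * ksign {u} (S - {u}) +
          ksign S (T - {u}) * (-1) ^ card S * ksign {u} (T - {u})) * (a * b * xs ! u) = 0" by simp
      then show ?thesis
        using True * by (simp add: L_def R_def single_add[symmetric] algebra_simps)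
    next
      case False
      then have "S \<inter> (T - {u}) \<noteq> {}" using u by auto
      then show ?thesis using False by (simp add: L_def R_def)
    qed
    have "L s = 0" if "s \<in> S - {u}" for s
    proof -
      have "(S - {s}) \<inter> T \<noteq> {}" using u that by blast
      then show ?thesis by (simp add: L_def)
    qed
    then have Lu: "sum L (S - {u}) = 0" by (rule sum.neutral[rule_format])
    have "R t = 0" if "t \<in> T - {u}" for t
    proof -
      have "S \<inter> (T - {t}) \<noteq> {}" using u that by blast
      then show ?thesis by (simp add: R_def)
    qed
    then have Ru: "sum R (T - {u}) = 0" by (rule sum.neutral[rule_format])
    have "sum L S = L u" "sum R T = R u"
      using fin u Lu Ru by (simp_all add: sum.remove[of _ u])
    then show ?thesis
      unfolding L R using False LR by (simp add: kmult_single additive.zero[OF additive_kdiff])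
  qed
qed

lemma kdiff_kmult:
  assumes "u \<in> kfin" "v \<in> kfin"
  shows "kdiff xs (kmult u v) = kmult (kdiff xs u) v + kmult (ktwist u) (kdiff xs v)"
  by (rule kmult_eqI[OF _ _ _ _ assms]; (intro additive_add_fun additive_kmult_right additive_kmult_left
     additive_compose[OF additive_kmult_right] additive_compose[OF additive_kmult_left]
     additive_compose[OF additive_kdiff] additive_kdiff additive_ktwist)?)
    (rule kdiff_kmult_single)

text \<open>Adding an element contributes a row and a column that cancel. The vanishing diagonal is
  a separate hypothesis because antisymmetry alone only gives
  \<open>p S S + p S S = 0\<close>.\<close>

lemma sum_alternating:
  fixes p :: "'i \<Rightarrow> 'i \<Rightarrow> 'b::ab_group_add"
  assumes "finite A" "\<And>S. S \<in> A \<Longrightarrow> p S S = 0"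
    and "\<And>S T. S \<in> A \<Longrightarrow> T \<in> A \<Longrightarrow> p S T = - p T S"
  shows "(\<Sum>S\<in>A. \<Sum>T\<in>A. p S T) = 0"
  using assms
proof (induction A rule: finite_induct)
  case empty
  show ?case by simp
next
  case (insert x A)
  have IH: "(\<Sum>S\<in>A. \<Sum>T\<in>A. p S T) = 0" using insert by blast
  have "(\<Sum>T\<in>A. p x T) = - (\<Sum>S\<in>A. p S x)"
    unfolding sum_negf[symmetric] by (intro sum.cong refl insert.prems(2)) auto
  then show ?case using insert.hyps insert.prems(1) IH by (simp add: sum.distrib)
qed

text \<open>Monomials of odd degree anticommute when disjoint and have square zero, so the double
  sum is alternating, also in characteristic two.\<close>

lemma kmult_self_odd:
  assumes "\<And>S. S \<in> supp l \<Longrightarrow> finite S \<and> odd (card S)"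
  shows "kmult l l = 0"
  unfolding kmult_alt
proof (rule sum_alternating)
  fix S T assume ST: "S \<in> supp l" "T \<in> supp l"
  show "(if S \<inter> T = {} then Poly_Mapping.single (S \<union> T) (ksign S T * coeff l S * coeff l T) else 0) =
    - (if T \<inter> S = {} then Poly_Mapping.single (T \<union> S) (ksign T S * coeff l T * coeff l S) else 0)"
  proof (cases "S \<inter> T = {}")
    case True
    have "ksign S T * ksign T S = (-1 :: 'a)"
      using ksign_swap[of S T] True assms[OF ST(1)] assms[OF ST(2)] by simp
    then have "ksign S T = - (ksign T S :: 'a)"
      by (metis ksign_square mult.commute mult.left_commute mult.right_neutral mult_minus1_right)
    then show ?thesis using True
      by (simp add: Un_commute Int_commute single_uminus[symmetric] algebra_simps)
  qed (simp add: Int_commute)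
next
  fix S assume "S \<in> supp l"
  then have "S \<noteq> {}" using assms by fastforce
  then show "(if S \<inter> S = {} then Poly_Mapping.single (S \<union> S) (ksign S S * coeff l S * coeff l S) else 0) = 0"
    by simp
qed simp

section \<open>Homogeneous components, and the coefficients of a differential\<close>

definition kproj :: "nat \<Rightarrow> 'a::comm_ring_1 koszul \<Rightarrow> 'a koszul"
  where "kproj q v = (\<Sum>S\<in>supp v. Poly_Mapping.single S (if card S = q then coeff v S else 0))"

lemma coeff_kproj: "coeff (kproj q v) S = (if card S = q then coeff v S else 0)"
  by (auto simp: kproj_def lookup_sum lookup_single when_def in_keys_iff)

lemma kproj_single:
  "kproj q (Poly_Mapping.single S a) = (if card S = q then Poly_Mapping.single S a else 0)"
  by (simp add: kproj_def)

lemma additive_kproj: "additive (kproj q)"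
  by standard (auto intro!: poly_mapping_eqI simp: coeff_kproj lookup_add)

lemma kproj_kdiff:
  assumes "v \<in> kfin"
  shows "kproj q (kdiff xs v) = kdiff xs (kproj (Suc q) v)"
proof (rule additive_eqI[of "\<lambda>v. kproj q (kdiff xs v)" "\<lambda>v. kdiff xs (kproj (Suc q) v)"])
  fix S assume "S \<in> supp v"
  then have "finite S" using assms by (auto simp: kfin_def)
  then have "card (S - {s}) = q \<longleftrightarrow> card S = Suc q" if "s \<in> S" for s
    using that by (metis card_Suc_Diff1 nat.inject)
  then show "kproj q (kdiff xs (Poly_Mapping.single S (coeff v S))) =
      kdiff xs (kproj (Suc q) (Poly_Mapping.single S (coeff v S)))"
    by (auto simp: kdiff_single kproj_single additive.sum[OF additive_kproj]
      additive.zero[OF additive_kdiff] intro!: sum.neutral)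
qed (intro additive_compose[OF additive_kdiff] additive_compose[OF additive_kproj]
  additive_kproj additive_kdiff)+

lemma kproj_kmult:
  assumes "v \<in> kfin" and l: "\<And>T. T \<in> supp l \<Longrightarrow> finite T \<and> card T = r"
  shows "kproj (q + r) (kmult v l) = kmult (kproj q v) l"
    and "q < r \<Longrightarrow> kproj q (kmult v l) = 0"
proof -
  \<comment> \<open>One formula covers both claims; the guard \<open>r \<le> p\<close> keeps the
    truncated difference \<open>p - r\<close> from selecting degree 0.\<close>
  have *: "kproj p (kmult v l) = (if r \<le> p then kmult (kproj (p - r) v) l else 0)" for p
  proof (rule additive_eqI[of "\<lambda>v. kproj p (kmult v l)"
        "\<lambda>v. if r \<le> p then kmult (kproj (p - r) v) l else 0"])
    show "additive (\<lambda>v. if r \<le> p then kmult (kproj (p - r) v) l else 0)"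
      by (cases "r \<le> p") (auto intro: additive.intro additive_compose[OF additive_kmult_left] additive_kproj)
    fix S assume "S \<in> supp v"
    then have S: "finite S" using assms by (auto simp: kfin_def)
    define u where "u = Poly_Mapping.single S (coeff v S)"
    show "kproj p (kmult u l) = (if r \<le> p then kmult (kproj (p - r) u) l else 0)"
    proof (rule additive_eqI[of "\<lambda>l. kproj p (kmult u l)"
          "\<lambda>l. if r \<le> p then kmult (kproj (p - r) u) l else 0"])
      show "additive (\<lambda>l. if r \<le> p then kmult (kproj (p - r) u) l else 0)"
        by (cases "r \<le> p") (auto intro: additive.intro additive_kmult_right)
      fix T assume "T \<in> supp l"
      then show "kproj p (kmult u (Poly_Mapping.single T (coeff l T))) =
        (if r \<le> p then kmult (kproj (p - r) u) (Poly_Mapping.single T (coeff l T)) else 0)"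
        using l[of T] S by (auto simp: u_def kmult_single kproj_single card_Un_disjoint
          additive.zero[OF additive_kproj] additive.zero[OF additive_kmult_left])
    qed (intro additive_compose[OF additive_kproj] additive_kmult_right)
  qed (intro additive_compose[OF additive_kproj] additive_kmult_left)
  show "kproj (q + r) (kmult v l) = kmult (kproj q v) l" using * by simp
  show "q < r \<Longrightarrow> kproj q (kmult v l) = 0" using * by simp
qed

text \<open>Only monomials \<open>insert u U\<close> with \<open>u\<close> outside \<open>U\<close>
  contribute at \<open>U\<close>. For a cycle this sum is zero and becomes a linear relation among
  the generators.\<close>

lemma coeff_kdiff:
  assumes v: "v \<in> koszul xs" and U: "U \<subseteq> {..<length xs}"
  shows "coeff (kdiff xs v) U =
    (\<Sum>u<length xs. (if u \<in> U then 0 else ksign {u} U * coeff v (insert u U)) * xs ! u)"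
proof (rule additive_eqI[of "\<lambda>v. coeff (kdiff xs v) U"])
  show "additive (\<lambda>v. coeff (kdiff xs v) U)"
    by standard (simp add: additive.add[OF additive_kdiff] lookup_add)
  show "additive (\<lambda>v. \<Sum>u<length xs.
      (if u \<in> U then 0 else ksign {u} U * coeff v (insert u U)) * xs ! u)"
    by (rule additive_sum_fun) (auto intro!: additive.intro simp: lookup_add algebra_simps)
  fix S assume "S \<in> supp v"
  then have S: "S \<subseteq> {..<length xs}" using v by (auto simp: koszul_def)
  show "coeff (kdiff xs (Poly_Mapping.single S (coeff v S))) U = (\<Sum>u<length xs.
      (if u \<in> U then 0 else ksign {u} U * coeff (Poly_Mapping.single S (coeff v S)) (insert u U)) * xs ! u)"
    unfolding kdiff_single lookup_sum
    by (rule sum.mono_neutral_cong) (use S in \<open>auto simp: lookup_single when_def finite_subset\<close>)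
qed

section \<open>Local rings and powers of the maximal ideal\<close>

text \<open>By Zorn's lemma, the proper principal ideal of a non-unit \<open>a\<close> would lie in
  a maximal ideal, which can only be \<open>\<mm>\<close>.\<close>

lemma unit_if_notin_maximal:
  fixes \<mm> :: "'a::comm_ring_1 set"
  assumes loc: "noetherian_local_ring \<mm>" and a: "a \<notin> \<mm>"
  shows "\<exists>b. b * a = 1"
proof (rule ccontr)
  assume no: "\<nexists>b. b * a = 1"
  \<comment> \<open>Properness is expressed as \<open>1 \<notin> J\<close>, a form that passes to
    unions of chains.\<close>
  define \<A> where "\<A> = {J. is_ideal J \<and> a \<in> J \<and> 1 \<notin> J}"
  note sub = module.subspace_def[OF module_times]
  have "is_ideal (range (\<lambda>k. k * a))"
    using module.subspace_span[OF module_times, of "{a}"]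
    by (simp add: module.span_singleton[OF module_times])
  moreover have "a \<in> range (\<lambda>k. k * a)" by (metis mult_1 rangeI)
  moreover have "1 \<notin> range (\<lambda>k. k * a)" using no by (metis imageE)
  ultimately have ne: "\<A> \<noteq> {}" unfolding \<A>_def by blast
  have "\<exists>M\<in>\<A>. \<forall>X\<in>\<A>. M \<subseteq> X \<longrightarrow> X = M"
  proof (rule subset_Zorn_nonempty[OF ne])
    fix \<C> assume C: "\<C> \<noteq> {}" "subset.chain \<A> \<C>"
    then have CA: "\<And>J. J \<in> \<C> \<Longrightarrow> is_ideal J \<and> a \<in> J \<and> 1 \<notin> J"
      by (auto simp: subset.chain_def \<A>_def)
    have "is_ideal (\<Union>\<C>)"
      unfolding sub
    proof (intro conjI ballI allI)
      show "0 \<in> \<Union>\<C>" using C(1) CA by (auto simp: sub)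
      show "c * x \<in> \<Union>\<C>" if "x \<in> \<Union>\<C>" for c x using that CA by (auto simp: sub)
      fix x y assume "x \<in> \<Union>\<C>" "y \<in> \<Union>\<C>"
      then obtain I J where IJ: "x \<in> I" "I \<in> \<C>" "y \<in> J" "J \<in> \<C>" by auto
      then have "I \<subseteq> J \<or> J \<subseteq> I" using C(2) by (auto simp: subset.chain_def)
      then obtain X where "X \<in> \<C>" "x \<in> X" "y \<in> X" using IJ by blast
      then show "x + y \<in> \<Union>\<C>" using CA[of X] by (auto simp: sub)
    qed
    then show "\<Union>\<C> \<in> \<A>" using C(1) CA by (auto simp: \<A>_def)
  qed
  then obtain M where M: "M \<in> \<A>" and max: "\<And>X. X \<in> \<A> \<Longrightarrow> M \<subseteq> X \<Longrightarrow> X = M" by blast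
  have "J = M \<or> J = UNIV" if J: "is_ideal J" "M \<subseteq> J" for J
  proof (cases "1 \<in> J")
    case True
    then have "c \<in> J" for c using J(1) by (metis mult.right_neutral sub)
    then show ?thesis by auto
  next
    case False
    then show ?thesis using max[of J] J M by (auto simp: \<A>_def)
  qed
  then have "is_maximal_ideal M" using M by (auto simp: is_maximal_ideal_def \<A>_def)
  then have "M = \<mm>" using loc by (auto simp: noetherian_local_ring_def)
  then show False using M a by (auto simp: \<A>_def)
qed

text \<open>A unit coefficient would make the corresponding generator redundant.\<close>

lemma relation_coeffs_in_maximal:
  fixes \<mm> :: "'a::comm_ring_1 set"
  assumes loc: "noetherian_local_ring \<mm>" and gen: "minimal_generators xs \<mm>"
    and rel: "(\<Sum>u<length xs. f u * xs ! u) = 0" and s: "s < length xs"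
  shows "f s \<in> \<mm>"
proof (rule ccontr)
  assume "f s \<notin> \<mm>"
  then obtain b where b: "b * f s = 1" using unit_if_notin_maximal[OF loc] by blast
  let ?Y = "set xs - {xs ! s}"
  have "f s * xs ! s + (\<Sum>u\<in>{..<length xs} - {s}. f u * xs ! u) = 0"
    using rel s by (simp add: sum.remove[of _ s])
  then have eq: "xs ! s = - b * (\<Sum>u\<in>{..<length xs} - {s}. f u * xs ! u)"
    using b by (metis add_eq_0_iff minus_mult_minus mult.assoc mult_1)
  \<comment> \<open>Distinctness of the list ensures that the other generators differ from
    \<open>xs ! s\<close> and so lie in \<open>?Y\<close>.\<close>
  have "f u * xs ! u \<in> ideal_gen ?Y" if "u \<in> {..<length xs} - {s}" for u
    using that s gen
    by (intro module.span_scale[OF module_times] module.span_base[OF module_times])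
      (auto simp: minimal_generators_def nth_eq_iff_index_eq)
  then have "xs ! s \<in> ideal_gen ?Y"
    by (subst eq) (rule module.span_scale[OF module_times], rule module.span_sum[OF module_times])
  then have "set xs \<subseteq> ideal_gen ?Y"
    using module.span_superset[OF module_times, of ?Y] by auto
  then have "ideal_gen ?Y = ideal_gen (set xs)"
    by (simp add: subset_antisym module.span_minimal[OF module_times] module.span_mono[OF module_times]
      module.subspace_span[OF module_times])
  moreover have "?Y \<subset> set xs" using nth_mem[OF s] by blast
  ultimately show False using gen unfolding minimal_generators_def by metis
qed

lemma is_ideal_ideal_power: "is_ideal (ideal_power \<mm> j)"
  by (cases j) (auto simp: ideal_power_def ideal_mult_def module.subspace_span[OF module_times]
    module.subspace_UNIV[OF module_times])

lemma ideal_power_Suc: "ideal_power \<mm> (Suc j) = ideal_mult (*) \<mm> (ideal_power \<mm> j)"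
  by (simp add: ideal_power_def)

lemma mult_ideal_power_Suc:
  "a \<in> \<mm> \<Longrightarrow> b \<in> ideal_power \<mm> j \<Longrightarrow> a * b \<in> ideal_power \<mm> (Suc j)"
  unfolding ideal_power_Suc ideal_mult_def by (intro module.span_base[OF module_times]) auto

lemma ideal_power_Suc_subset: "ideal_power \<mm> (Suc j) \<subseteq> ideal_power \<mm> j"
  unfolding ideal_power_Suc ideal_mult_def
  using is_ideal_ideal_power[of \<mm> j]
  by (intro module.span_minimal[OF module_times])
    (auto intro: module.subspace_scale[OF module_times])

section \<open>Multiples of free modules by an ideal, read off from coefficients\<close>

definition kcoeffs :: "'a::comm_ring_1 list \<Rightarrow> 'a set \<Rightarrow> 'a koszul set"
  where "kcoeffs xs I = {v \<in> koszul xs. \<forall>S. coeff v S \<in> I}"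

lemma subspace_kcoeffs:
  assumes "is_ideal I"
  shows "module.subspace kscale (kcoeffs xs I)"
  unfolding module.subspace_def[OF module_kscale]
proof (intro conjI ballI allI)
  fix u v assume uv: "u \<in> kcoeffs xs I" "v \<in> kcoeffs xs I"
  then have "S \<subseteq> {..<length xs}" if "S \<in> supp (u + v)" for S
    using subsetD[OF keys_add that] unfolding kcoeffs_def koszul_def by blast
  then show "u + v \<in> kcoeffs xs I"
    using uv assms
    by (simp add: kcoeffs_def koszul_def lookup_add module.subspace_add[OF module_times])
qed (use assms in \<open>auto simp: kcoeffs_def koszul_def lookup_kscale in_keys_iff
  module.subspace_def[OF module_times]\<close>)

text \<open>The Koszul complex is free on its exterior monomials, so an element with coefficients in
  \<open>I\<close> is a sum of \<open>I\<close>-multiples of basis elements.\<close>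

lemma ideal_mult_koszul:
  assumes I: "is_ideal I"
  shows "ideal_mult kscale I (koszul xs) = kcoeffs xs I"
proof
  show "ideal_mult kscale I (koszul xs) \<subseteq> kcoeffs xs I"
    unfolding ideal_mult_def
  proof (rule module.span_minimal[OF module_kscale _ subspace_kcoeffs[OF I]], clarify)
    fix a v assume "a \<in> I" "v \<in> koszul xs"
    then show "kscale a v \<in> kcoeffs xs I"
      using module.subspace_scale[OF module_times I]
      by (auto simp: kcoeffs_def koszul_def lookup_kscale in_keys_iff mult.commute)
  qed
  show "kcoeffs xs I \<subseteq> ideal_mult kscale I (koszul xs)"
  proof
    fix v assume v: "v \<in> kcoeffs xs I"
    have "Poly_Mapping.single S (coeff v S) \<in> ideal_mult kscale I (koszul xs)" if "S \<in> supp v" for S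
    proof -
      have "Poly_Mapping.single S (coeff v S) = kscale (coeff v S) (Poly_Mapping.single S 1)"
        by (rule poly_mapping_eqI) (simp add: lookup_kscale lookup_single when_def)
      moreover have "Poly_Mapping.single S 1 \<in> koszul xs" "coeff v S \<in> I"
        using v that by (auto simp: kcoeffs_def koszul_def)
      ultimately show ?thesis
        unfolding ideal_mult_def by (intro module.span_base[OF module_kscale]) blast
    qed
    then have "(\<Sum>S\<in>supp v. Poly_Mapping.single S (coeff v S)) \<in> ideal_mult kscale I (koszul xs)"
      unfolding ideal_mult_def by (intro module.span_sum[OF module_kscale])
    then show "v \<in> ideal_mult kscale I (koszul xs)" by (simp add: sum_single_coeff)
  qed
qed

text \<open>The same argument with the basis of products of an exterior monomial and a divided power
  \<open>y^(i)\<close>.\<close>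

lemma ideal_mult_divpow:
  assumes I: "is_ideal I"
  shows "ideal_mult dscale I (divpow xs) = {w. \<forall>i. coeff w i \<in> kcoeffs xs I}"
proof
  note ksub = subspace_kcoeffs[OF I, of xs, unfolded module.subspace_def[OF module_kscale]]
  have "module.subspace dscale {w. \<forall>i. coeff w i \<in> kcoeffs xs I}"
    unfolding module.subspace_def[OF module_dscale]
    using ksub by (auto simp: lookup_add lookup_dscale)
  then show "ideal_mult dscale I (divpow xs) \<subseteq> {w. \<forall>i. coeff w i \<in> kcoeffs xs I}"
    unfolding ideal_mult_def
  proof (rule module.span_minimal[OF module_dscale, rotated], clarify)
    fix a v i assume "a \<in> I" "v \<in> divpow xs"
    then show "coeff (dscale a v) i \<in> kcoeffs xs I"
      unfolding ideal_mult_koszul[OF I, symmetric] ideal_mult_def lookup_dscale divpow_def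
      by (intro module.span_base[OF module_kscale]) blast
  qed
  show "{w. \<forall>i. coeff w i \<in> kcoeffs xs I} \<subseteq> ideal_mult dscale I (divpow xs)"
  proof clarify
    fix w :: "'a divpow" assume w: "\<forall>i. coeff w i \<in> kcoeffs xs I"
    have "Poly_Mapping.single i (Poly_Mapping.single S (coeff (coeff w i) S))
        \<in> ideal_mult dscale I (divpow xs)" if "S \<in> supp (coeff w i)" for i :: nat and S
    proof -
      have "Poly_Mapping.single i (Poly_Mapping.single S (coeff (coeff w i) S)) =
          dscale (coeff (coeff w i) S) (Poly_Mapping.single i (Poly_Mapping.single S 1))"
        by (intro poly_mapping_eqI) (simp add: lookup_dscale lookup_kscale lookup_single when_def)
      moreover have "Poly_Mapping.single i (Poly_Mapping.single S 1) \<in> divpow xs"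
        using w that by (auto simp: kcoeffs_def koszul_def divpow_def lookup_single when_def)
      moreover have "coeff (coeff w i) S \<in> I" using w by (auto simp: kcoeffs_def)
      ultimately show ?thesis
        unfolding ideal_mult_def by (intro module.span_base[OF module_dscale]) blast
    qed
    then have "(\<Sum>i\<in>supp w. \<Sum>S\<in>supp (coeff w i).
        Poly_Mapping.single i (Poly_Mapping.single S (coeff (coeff w i) S)))
        \<in> ideal_mult dscale I (divpow xs)"
      unfolding ideal_mult_def by (intro module.span_sum[OF module_dscale])
    then show "w \<in> ideal_mult dscale I (divpow xs)"
      by (simp add: additive.sum[OF additive_single, symmetric] sum_single_coeff)
  qed
qed

section \<open>Cycles of the divided power extension\<close>

lemma kcoeffs_kfin: "v \<in> kcoeffs xs I \<Longrightarrow> v \<in> kfin"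
  by (auto simp: kcoeffs_def koszul_def kfin_def intro: finite_subset)

lemma zero_in_kcoeffs: "is_ideal I \<Longrightarrow> 0 \<in> kcoeffs xs I"
  by (simp add: module.subspace_0[OF module_kscale] subspace_kcoeffs)

lemma diff_in_kcoeffs:
  "is_ideal I \<Longrightarrow> u \<in> kcoeffs xs I \<Longrightarrow> v \<in> kcoeffs xs I \<Longrightarrow> u - v \<in> kcoeffs xs I"
  by (simp add: module.subspace_diff[OF module_kscale] subspace_kcoeffs)

lemma ktwist_in_kcoeffs:
  "is_ideal I \<Longrightarrow> v \<in> kcoeffs xs I \<Longrightarrow> ktwist v \<in> kcoeffs xs I"
  by (auto simp: kcoeffs_def koszul_def coeff_ktwist module.subspace_scale[OF module_times])

lemma supp_kproj: "S \<in> supp (kproj q v) \<longleftrightarrow> S \<in> supp v \<and> card S = q"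
  by (simp add: in_keys_iff coeff_kproj)

lemma kproj_homogeneous:
  "(\<And>S. S \<in> supp v \<Longrightarrow> card S = q) \<Longrightarrow> kproj q v = v"
  by (rule poly_mapping_eqI) (auto simp: coeff_kproj in_keys_iff)

lemma kproj_in_kcoeffs:
  "is_ideal I \<Longrightarrow> v \<in> kcoeffs xs I \<Longrightarrow> kproj q v \<in> kcoeffs xs I"
  by (auto simp: kcoeffs_def koszul_def coeff_kproj supp_kproj module.subspace_0[OF module_times])

text \<open>A factor with coefficients in \<open>\<mm>\<close> gains one power of
  \<open>\<mm>\<close>. Applied to \<open>l\<close>, this recovers the power lost in condition
  P.\<close>

lemma kmult_in_kcoeffs:
  assumes m: "is_ideal \<mm>"
    and u: "u \<in> kcoeffs xs (ideal_power \<mm> j)" and v: "v \<in> kcoeffs xs \<mm>"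
  shows "kmult u v \<in> kcoeffs xs (ideal_power \<mm> (Suc j))"
  unfolding kmult_alt
proof (intro module.subspace_sum[OF module_kscale] subspace_kcoeffs is_ideal_ideal_power)
  fix S T assume "S \<in> supp u" "T \<in> supp v"
  then have "S \<union> T \<subseteq> {..<length xs}" using u v by (auto simp: kcoeffs_def koszul_def)
  moreover have "coeff v T * coeff u S \<in> ideal_power \<mm> (Suc j)"
    using u v by (intro mult_ideal_power_Suc) (auto simp: kcoeffs_def)
  then have "ksign S T * (coeff v T * coeff u S) \<in> ideal_power \<mm> (Suc j)"
    by (rule module.subspace_scale[OF module_times is_ideal_ideal_power])
  then have "ksign S T * coeff u S * coeff v T \<in> ideal_power \<mm> (Suc j)"
    by (simp add: mult.commute mult.left_commute)
  moreover have "0 \<in> ideal_power \<mm> (Suc j)"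
    by (intro module.subspace_0[OF module_times] is_ideal_ideal_power)
  ultimately show "(if S \<inter> T = {} then Poly_Mapping.single (S \<union> T)
      (ksign S T * coeff u S * coeff v T) else 0) \<in> kcoeffs xs (ideal_power \<mm> (Suc j))"
    by (auto simp: kcoeffs_def koszul_def lookup_single when_def)
qed

lemma kdiff_kproj_0:
  assumes "v \<in> kfin"
  shows "kdiff xs (kproj 0 v) = 0"
proof (rule additive_eqI[of "\<lambda>v. kdiff xs (kproj 0 v)" "\<lambda>v. 0"])
  fix S assume "S \<in> supp v"
  then show "kdiff xs (kproj 0 (Poly_Mapping.single S (coeff v S))) = 0"
    using assms by (auto simp: kproj_single kdiff_single kfin_def additive.zero[OF additive_kdiff])
qed (auto intro: additive_compose[OF additive_kdiff] additive_kproj additive.intro)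

lemma kdiff_kproj_cycle:
  assumes "v \<in> kfin" "kdiff xs v = 0"
  shows "kdiff xs (kproj q v) = 0"
proof (cases q)
  case 0
  then show ?thesis using kdiff_kproj_0 assms by simp
next
  case (Suc p)
  then show ?thesis
    using kproj_kdiff[of v p xs] assms by (simp add: additive.zero[OF additive_kproj])
qed

text \<open>In positive degree, every coefficient of a Koszul cycle enters a linear relation among the
  minimal generators.\<close>

lemma koszul_cycle_in_maximal:
  assumes loc: "noetherian_local_ring \<mm>" and gen: "minimal_generators xs \<mm>"
    and r: "r \<ge> 1" and l: "l \<in> koszul_deg xs r" "kdiff xs l = 0"
  shows "l \<in> kcoeffs xs \<mm>"
proof -
  have m: "is_ideal \<mm>" using loc by (simp add: noetherian_local_ring_def is_maximal_ideal_def)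
  have lk: "l \<in> koszul xs" using l by (auto simp: koszul_deg_def koszul_def)
  have "coeff l S \<in> \<mm>" for S
  proof (cases "S \<in> supp l")
    case False
    then show ?thesis using module.subspace_0[OF module_times m] by (simp add: in_keys_iff)
  next
    case True
    then have S: "S \<subseteq> {..<length xs}" "card S = r" using l by (auto simp: koszul_deg_def)
    \<comment> \<open>Positive degree makes \<open>S\<close> nonempty. In the relation read off at
      \<open>S - {s}\<close>, the generator with index \<open>s\<close> has coefficient
      \<open>coeff l S\<close> up to a sign that squares to 1.\<close>
    then obtain s where s: "s \<in> S" using r by fastforce
    let ?U = "S - {s}"
    let ?f = "\<lambda>u. if u \<in> ?U then 0 else ksign {u} ?U * coeff l (insert u ?U)"
    have "(\<Sum>u<length xs. ?f u * xs ! u) = 0"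
      using coeff_kdiff[OF lk, of ?U] S l(2) by auto
    then have "?f s \<in> \<mm>"
      by (rule relation_coeffs_in_maximal[OF loc gen]) (use s S in auto)
    then have "ksign {s} ?U * (ksign {s} ?U * coeff l S) \<in> \<mm>"
      using s by - (rule module.subspace_scale[OF module_times m], simp add: insert_absorb)
    then show ?thesis by simp
  qed
  then show ?thesis using lk by (simp add: kcoeffs_def)
qed

text \<open>Condition P yields elements that need not be homogeneous; taking the degree
  \<open>d\<close> component of the resulting equation makes them so.\<close>

lemma condition_P_homogeneous:
  assumes P: "condition_P xs \<mm> t r l"
    and b: "b \<in> kcoeffs xs (ideal_power \<mm> t)" "kdiff xs b = 0" "\<And>S. S \<in> supp b \<Longrightarrow> card S = d"
  shows "\<exists>z c. z \<in> kcoeffs xs (ideal_power \<mm> (t - 1)) \<and> kdiff xs z = 0 \<and>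
    (\<forall>S\<in>supp z. card S + r = d) \<and> c \<in> kcoeffs xs (ideal_power \<mm> (t - 1)) \<and>
    (\<forall>S\<in>supp c. card S = Suc d) \<and> b = kmult z l + kdiff xs c"
proof -
  note I = is_ideal_ideal_power
  note mK = mK_def[of xs \<mm>, unfolded ideal_mult_koszul[OF I]]
  have "b \<in> mK_cycles xs \<mm> t" using b by (simp add: mK_cycles_def mK)
  then obtain z0 where z0: "z0 \<in> mK_cycles xs \<mm> (t - 1)"
      "b - kmult z0 l \<in> mK_boundaries xs \<mm> (t - 1)"
    using P unfolding condition_P_def by blast
  then obtain c0 where c0: "c0 \<in> kcoeffs xs (ideal_power \<mm> (t - 1))" "b - kmult z0 l = kdiff xs c0"
    by (auto simp: mK_boundaries_def mK)
  have z0': "z0 \<in> kcoeffs xs (ideal_power \<mm> (t - 1))" "kdiff xs z0 = 0"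
    using z0(1) by (auto simp: mK_cycles_def mK)
  have l: "finite T \<and> card T = r" if "T \<in> supp l" for T
    using that P by (auto simp: condition_P_def cycles_deg_def koszul_deg_def intro: finite_subset)
  \<comment> \<open>For \<open>d < r\<close> the product \<open>kmult z0 l\<close> has no component
    in degree \<open>d\<close>, so zero is the right choice.\<close>
  define z where "z = (if r \<le> d then kproj (d - r) z0 else 0)"
  have zl: "kproj d (kmult z0 l) = kmult z l"
    using kproj_kmult(1)[OF kcoeffs_kfin[OF z0'(1)] l, where q = "d - r"]
      kproj_kmult(2)[OF kcoeffs_kfin[OF z0'(1)] l, where q = d]
    by (auto simp: z_def additive.zero[OF additive_kmult_left])
  have "kproj d b = b"
    using b(3) by (rule kproj_homogeneous)
  moreover have "b = kmult z0 l + kdiff xs c0" using c0(2) by (simp add: algebra_simps)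
  ultimately have eq: "b = kmult z l + kdiff xs (kproj (Suc d) c0)"
    using kproj_kdiff[OF kcoeffs_kfin[OF c0(1)], of d xs] zl
    by (metis additive.add[OF additive_kproj])
  show ?thesis
  proof (intro exI conjI ballI)
    show "z \<in> kcoeffs xs (ideal_power \<mm> (t - 1))"
      using z0' by (auto simp: z_def I zero_in_kcoeffs kproj_in_kcoeffs)
    show "kdiff xs z = 0"
      using kdiff_kproj_cycle[OF kcoeffs_kfin[OF z0'(1)] z0'(2)]
      by (simp add: z_def additive.zero[OF additive_kdiff])
    show "card S + r = d" if "S \<in> supp z" for S
      using that by (auto simp: z_def supp_kproj split: if_splits)
    show "kproj (Suc d) c0 \<in> kcoeffs xs (ideal_power \<mm> (t - 1))"
      using c0 by (simp add: I kproj_in_kcoeffs)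
  qed (use eq in \<open>auto simp: supp_kproj\<close>)
qed

section \<open>The differential and the graded pieces, coefficient by coefficient\<close>

lemma additive_ddiff: "additive (ddiff xs l)"
  unfolding ddiff_def
  by (rule additive_sum_supp[of "\<lambda>i b. Poly_Mapping.single i (kdiff xs b) +
      (if i = 0 then 0 else Poly_Mapping.single (i - 1) (kmult (ktwist b) l))"])
    (auto intro!: additive.intro simp: additive.add[OF additive_kdiff] additive.add[OF additive_ktwist]
      additive.add[OF additive_kmult_left] single_add)

lemma ddiff_single:
  "ddiff xs l (Poly_Mapping.single j b) = Poly_Mapping.single j (kdiff xs b) +
    (if j = 0 then 0 else Poly_Mapping.single (j - 1) (kmult (ktwist b) l))"
  by (cases "b = 0") (simp_all add: ddiff_def additive.zero[OF additive_kdiff]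
    additive.zero[OF additive_ktwist] additive.zero[OF additive_kmult_left])

text \<open>Indexing by the target position, which receives the \<open>l\<close>-term from
  \<open>Suc i\<close>, removes the case distinction at 0.\<close>

lemma coeff_ddiff:
  "coeff (ddiff xs l w) i = kdiff xs (coeff w i) + kmult (ktwist (coeff w (Suc i))) l"
proof (rule additive_eqI[of "\<lambda>w. coeff (ddiff xs l w) i"
      "\<lambda>w. kdiff xs (coeff w i) + kmult (ktwist (coeff w (Suc i))) l"])
  note add = additive.add[OF additive_kdiff] additive.add[OF additive_ktwist]
    additive.add[OF additive_kmult_left] additive.add[OF additive_ddiff]
  note zero = additive.zero[OF additive_kdiff] additive.zero[OF additive_ktwist]
    additive.zero[OF additive_kmult_left]
  show "additive (\<lambda>w. coeff (ddiff xs l w) i)"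
    by standard (simp add: add lookup_add)
  show "additive (\<lambda>w. kdiff xs (coeff w i) + kmult (ktwist (coeff w (Suc i))) l)"
    by standard (simp add: add lookup_add)
  fix j
  show "coeff (ddiff xs l (Poly_Mapping.single j (coeff w j))) i =
    kdiff xs (coeff (Poly_Mapping.single j (coeff w j)) i) +
    kmult (ktwist (coeff (Poly_Mapping.single j (coeff w j)) (Suc i))) l"
    unfolding ddiff_single by (auto simp: lookup_add lookup_single when_def zero)
qed

text \<open>The degree condition becomes an equation free of truncated subtraction, and it is
  vacuous where the coefficient vanishes.\<close>

lemma mB_deg_iff:
  "w \<in> mB_deg xs \<mm> r j p \<longleftrightarrow> (\<forall>i. coeff w i \<in> kcoeffs xs (ideal_power \<mm> j) \<and>
    (\<forall>S\<in>supp (coeff w i). card S + i * (r + 1) = p))"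
proof -
  have "w \<in> divpow_deg xs r p \<longleftrightarrow> (\<forall>i. \<forall>S\<in>supp (coeff w i). card S + i * (r + 1) = p)"
    if w: "\<And>i. coeff w i \<in> kcoeffs xs (ideal_power \<mm> j)"
  proof
    assume deg: "w \<in> divpow_deg xs r p"
    show "\<forall>i. \<forall>S\<in>supp (coeff w i). card S + i * (r + 1) = p"
    proof (intro allI ballI)
      fix i S assume S: "S \<in> supp (coeff w i)"
      then have "i \<in> supp w" by (auto simp: in_keys_iff)
      then have "i * (r + 1) \<le> p" "coeff w i \<in> koszul_deg xs (p - i * (r + 1))"
        using deg unfolding divpow_deg_def by blast+
      then show "card S + i * (r + 1) = p" using S unfolding koszul_deg_def by auto
    qed
  next
    assume deg: "\<forall>i. \<forall>S\<in>supp (coeff w i). card S + i * (r + 1) = p"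
    show "w \<in> divpow_deg xs r p"
      unfolding divpow_deg_def
    proof (intro CollectI ballI conjI)
      fix i assume "i \<in> supp w"
      then have "coeff w i \<noteq> 0" by (simp add: in_keys_iff)
      \<comment> \<open>A nonzero coefficient contains a monomial, whose degree equation yields the
        bound on \<open>i * (r + 1)\<close>.\<close>
      then obtain S where "S \<in> supp (coeff w i)" by (metis equals0I keys_eq_empty)
      then show "i * (r + 1) \<le> p" using deg by (metis le_add2)
      have "card S = p - i * (r + 1)" if "S \<in> supp (coeff w i)" for S
        using deg that by (metis add_diff_cancel_right')
      then show "coeff w i \<in> koszul_deg xs (p - i * (r + 1))"
        using w[of i] unfolding koszul_deg_def kcoeffs_def koszul_def by blast
    qed
  qed
  then show ?thesis
    unfolding mB_deg_def ideal_mult_divpow[OF is_ideal_ideal_power] by blast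
qed

lemma zero_in_mB_deg: "0 \<in> mB_deg xs \<mm> r j p"
  by (simp add: mB_deg_iff zero_in_kcoeffs is_ideal_ideal_power)

lemma diff_in_mB_deg:
  assumes "u \<in> mB_deg xs \<mm> r j p" "v \<in> mB_deg xs \<mm> r j p"
  shows "u - v \<in> mB_deg xs \<mm> r j p"
  unfolding mB_deg_iff lookup_minus
proof (intro allI conjI ballI)
  show "coeff u i - coeff v i \<in> kcoeffs xs (ideal_power \<mm> j)" for i
    using assms by (simp add: mB_deg_iff diff_in_kcoeffs is_ideal_ideal_power)
  fix i S assume "S \<in> supp (coeff u i - coeff v i)"
  then have "S \<in> supp (coeff u i) \<or> S \<in> supp (coeff v i)"
    using keys_diff by fastforce
  then show "card S + i * (r + 1) = p" using assms unfolding mB_deg_iff by blast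
qed

text \<open>The induction is on a strict bound \<open>n\<close> for the exponents of
  \<open>y\<close>: bound 0 means \<open>w = 0\<close>, and bound \<open>Suc n\<close> makes
  position \<open>n\<close> the top, possibly with zero coefficient.\<close>

lemma cycle_is_boundary:
  assumes loc: "noetherian_local_ring \<mm>" and gen: "minimal_generators xs \<mm>"
    and t: "t \<ge> 1" and r: "odd r" and P: "condition_P xs \<mm> t r l"
    and w: "w \<in> mB_deg xs \<mm> r t p" "ddiff xs l w = 0" and n: "supp w \<subseteq> {..<n}"
  shows "\<exists>u \<in> mB_deg xs \<mm> r (t - 1) (Suc p). w = ddiff xs l u"
  using w n
proof (induction n arbitrary: w)
  case 0
  then have "w = ddiff xs l 0" by (simp add: additive.zero[OF additive_ddiff])
  then show ?case using zero_in_mB_deg by blast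
next
  case (Suc n)
  note I = is_ideal_ideal_power
  note zero = additive.zero[OF additive_kdiff] additive.zero[OF additive_ktwist]
    additive.zero[OF additive_kmult_left] 
  have m: "is_ideal \<mm>" using loc by (simp add: noetherian_local_ring_def is_maximal_ideal_def)
  have l: "l \<in> koszul_deg xs r" "kdiff xs l = 0"
    using P by (auto simp: condition_P_def cycles_deg_def)
  have "r \<ge> 1" using r by (cases r) auto
  then have lm: "l \<in> kcoeffs xs \<mm>" using koszul_cycle_in_maximal[OF loc gen _ l] by blast
  note lfin = kcoeffs_kfin[OF lm]
  have ll: "kmult l l = 0"
    using l r by (intro kmult_self_odd) (auto simp: koszul_deg_def intro: finite_subset)
  define b where "b = coeff w n"
  have wtop: "coeff w i = 0" if "i > n" for i
    using Suc.prems(3) that by (auto simp: in_keys_iff subset_iff)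
  have wI: "coeff w i \<in> kcoeffs xs (ideal_power \<mm> t)"
    and wdeg: "S \<in> supp (coeff w i) \<Longrightarrow> card S + i * (r + 1) = p" for i S
    using Suc.prems(1) unfolding mB_deg_iff by blast+
  have cyc: "kdiff xs (coeff w i) + kmult (ktwist (coeff w (Suc i))) l = 0" for i
    unfolding coeff_ddiff[symmetric] Suc.prems(2) by simp
  have "b \<in> kcoeffs xs (ideal_power \<mm> t)" using wI b_def by simp
  moreover have db: "kdiff xs b = 0" using cyc[of n] wtop[of "Suc n"] by (simp add: b_def zero)
  moreover have "\<And>S. S \<in> supp b \<Longrightarrow> card S = p - n * (r + 1)"
    using wdeg[of _ n] by (fastforce simp: b_def)
  ultimately obtain z c where
    z: "z \<in> kcoeffs xs (ideal_power \<mm> (t - 1))" "kdiff xs z = 0"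
      "\<And>S. S \<in> supp z \<Longrightarrow> card S + r = p - n * (r + 1)"
    and c: "c \<in> kcoeffs xs (ideal_power \<mm> (t - 1))" "\<And>S. S \<in> supp c \<Longrightarrow> card S = Suc (p - n * (r + 1))"
    and bzc: "b = kmult z l + kdiff xs c"
    using condition_P_homogeneous[OF P, of b "p - n * (r + 1)"] by blast
  show ?case
  proof (cases "b = 0")
    case True
    then have "supp w \<subseteq> {..<n}"
      using Suc.prems(3) by (auto simp: b_def in_keys_iff less_Suc_eq subset_iff)
    then show ?thesis using Suc.IH Suc.prems by blast
  next
    case False
    \<comment> \<open>A monomial of \<open>b\<close> shows that \<open>p - n * (r + 1)\<close> is
      not truncated, on which the degree count for \<open>u\<close> rests.\<close>
    then obtain S where "S \<in> supp b" by (metis equals0I keys_eq_empty)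
    then have np: "n * (r + 1) \<le> p" using wdeg[of S n] by (simp add: b_def)
    \<comment> \<open>The twist on \<open>z\<close> undoes the one in \<open>ddiff\<close>, so the
      coefficient of \<open>ddiff xs l u\<close> at \<open>n\<close> is
      \<open>kmult z l + kdiff xs c\<close>, which is \<open>b\<close>.\<close>
    define u where "u = Poly_Mapping.single (Suc n) (ktwist z) + Poly_Mapping.single n c"
    have u: "u \<in> mB_deg xs \<mm> r (t - 1) (Suc p)"
      unfolding mB_deg_iff
    proof (intro allI conjI ballI)
      have uc: "coeff u i = (if i = Suc n then ktwist z else if i = n then c else 0)" for i
        by (simp add: u_def lookup_add lookup_single when_def)
      show "coeff u i \<in> kcoeffs xs (ideal_power \<mm> (t - 1))" for i
        using z c by (simp add: uc I ktwist_in_kcoeffs zero_in_kcoeffs)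
      fix i S assume "S \<in> supp (coeff u i)"
      then consider "i = Suc n" "S \<in> supp z" | "i = n" "S \<in> supp c"
        by (auto simp: uc split: if_splits)
      then show "card S + i * (r + 1) = Suc p"
        by cases (use z(3)[of S] c(2)[of S] np in auto)
    qed
    define v where "v = kmult (ktwist c) l"
    have du: "coeff (ddiff xs l u) i = (if i = n then b else if Suc i = n then v else 0)" for i
      unfolding coeff_ddiff u_def lookup_add lookup_single when_def
      using kdiff_ktwist[OF kcoeffs_kfin[OF z(1)]] z(2)
      by (auto simp: zero bzc v_def add.commute)
    have tc: "ktwist c \<in> kfin" and tz: "ktwist z \<in> kfin"
      using kcoeffs_kfin ktwist_in_kcoeffs[OF I] z(1) c(1) by blast+
    have zll: "kmult (kmult (ktwist z) l) l = 0" "kmult v l = 0"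
      using kmult_assoc[OF tz lfin lfin] kmult_assoc[OF tc lfin lfin] ll
      by (simp_all add: v_def additive.zero[OF additive_kmult_right])
    have tl: "ktwist l = - l"
    proof (rule poly_mapping_eqI)
      fix S
      show "coeff (ktwist l) S = coeff (- l) S"
        using l r by (cases "coeff l S = 0") (auto simp: coeff_ktwist koszul_deg_def in_keys_iff)
    qed
    \<comment> \<open>This is the coefficient of the double differential of \<open>u\<close> at
      position \<open>n - 1\<close>. The part from \<open>z\<close> dies because \<open>l\<close>
      has square zero; the rest cancels by the Leibniz rule, as \<open>l\<close> is a cycle.\<close>
    have "kmult (ktwist b) l + kdiff xs v = 0"
    proof -
      have "kmult (ktwist b) l = kmult (kmult (ktwist z) (- l)) l + kmult (ktwist (kdiff xs c)) l"
        unfolding bzc tl[symmetric] ktwist_kmult[OF kcoeffs_kfin[OF z(1)] lfin, symmetric]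
        by (simp add: additive.add[OF additive_ktwist] additive.add[OF additive_kmult_left])
      also have "\<dots> = kmult (ktwist (kdiff xs c)) l"
        using zll by (simp add: additive.minus[OF additive_kmult_right] additive.minus[OF additive_kmult_left])
      also have "\<dots> = - kmult (kdiff xs (ktwist c)) l"
        by (simp add: kdiff_ktwist[OF kcoeffs_kfin[OF c(1)]] additive.minus[OF additive_kmult_left])
      also have "\<dots> = - kdiff xs v"
        unfolding v_def kdiff_kmult[OF tc lfin] l(2)
        by (simp add: additive.zero[OF additive_kmult_right])
      finally show ?thesis by simp
    qed
    moreover have "ktwist v = kmult c (- l)"
      unfolding v_def ktwist_kmult[OF tc lfin] tl by simp
    \<comment> \<open>This is the coefficient at position \<open>n - 2\<close>; the one at
      \<open>n\<close> is \<open>kdiff xs b\<close>, already known to vanish.\<close>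
    moreover have "kmult (kmult c (- l)) l = 0"
      using kmult_assoc[OF kcoeffs_kfin[OF c(1)] lfin lfin] ll
      by (simp add: additive.minus[OF additive_kmult_right] additive.minus[OF additive_kmult_left]
        additive.zero[OF additive_kmult_right])
    ultimately have ddu: "ddiff xs l (ddiff xs l u) = 0"
      using db
      by (intro poly_mapping_eqI) (auto simp: coeff_ddiff[of _ _ "ddiff xs l u"] du zero add.commute)
    \<comment> \<open>The factor \<open>l\<close> raises the exponent from \<open>t - 1\<close> to
      \<open>Suc (t - 1)\<close>, which is \<open>t\<close> since \<open>t \<ge> 1\<close>.\<close>
    have v: "v \<in> kcoeffs xs (ideal_power \<mm> t)"
      using kmult_in_kcoeffs[OF m ktwist_in_kcoeffs[OF I c(1)] lm] t by (simp add: v_def)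
    have vdeg: "card S + i * (r + 1) = p" if "S \<in> supp v" "Suc i = n" for S i
    proof -
      have "kproj (Suc (p - n * (r + 1))) (ktwist c) = ktwist c"
        by (intro kproj_homogeneous) (simp add: c(2))
      then have "kproj (Suc (p - n * (r + 1)) + r) v = v"
        unfolding v_def using l
        by (subst kproj_kmult(1)[OF tc]) (auto simp: koszul_deg_def intro: finite_subset)
      then have "card S = Suc (p - n * (r + 1)) + r"
        using that(1) by (metis supp_kproj)
      then show ?thesis using np that(2) by auto
    qed
    \<comment> \<open>A boundary of \<open>u\<close> lies a priori only in the subcomplex for
      \<open>t - 1\<close>, but its coefficients \<open>b\<close> and \<open>v\<close> both belong
      to the one for \<open>t\<close>, so \<open>w'\<close> does too.\<close>
    define w' where "w' = w - ddiff xs l u"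
    have w'coeff: "coeff w' i = (if i = n then 0 else if Suc i = n then coeff w i - v else coeff w i)" for i
      by (simp add: w'_def lookup_minus du b_def)
    have "w' \<in> mB_deg xs \<mm> r t p"
      unfolding mB_deg_iff
    proof (intro allI conjI ballI)
      show "coeff w' i \<in> kcoeffs xs (ideal_power \<mm> t)" for i
        using wI v by (simp add: w'coeff I zero_in_kcoeffs diff_in_kcoeffs)
      show "card S + i * (r + 1) = p" if "S \<in> supp (coeff w' i)" for i S
        using that wdeg vdeg keys_diff[of "coeff w i" v] by (auto simp: w'coeff split: if_splits)
    qed
    moreover have "ddiff xs l w' = 0"
      unfolding w'_def using Suc.prems(2) ddu by (simp add: additive.diff[OF additive_ddiff])
    moreover have "supp w' \<subseteq> {..<n}"
    proof
      fix i assume "i \<in> supp w'"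
      then show "i \<in> {..<n}"
        using wtop[of i] by (cases i n rule: linorder_cases) (auto simp: in_keys_iff w'coeff)
    qed
    ultimately obtain u' where "u' \<in> mB_deg xs \<mm> r (t - 1) (Suc p)" "w' = ddiff xs l u'"
      using Suc.IH by blast
    \<comment> \<open>This is \<open>u' + u\<close>, written with differences so that closure under
      subtraction applies.\<close>
    then have "u' - (0 - u) \<in> mB_deg xs \<mm> r (t - 1) (Suc p)"
      using u by (intro diff_in_mB_deg zero_in_mB_deg)
    moreover have "w = ddiff xs l (u' - (0 - u))"
      using \<open>w' = ddiff xs l u'\<close> by (simp add: w'_def additive.add[OF additive_ddiff] algebra_simps)
    ultimately show ?thesis by blast
  qed
qed

theorem theorem4p2:
  fixes \<mm> :: "'a::comm_ring_1 set" and xs :: "'a list"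
    and t r i :: nat and l :: "'a koszul"
  assumes "noetherian_local_ring \<mm>"
    and "minimal_generators xs \<mm>"
    and "t \<ge> 2" and "r \<ge> 1" and "odd r"
    and "condition_P xs \<mm> t r l"
  shows "\<forall>X \<in> homology (mB_deg xs \<mm> r t) (ddiff xs l) i.
    homology_map (\<lambda>w. w) (mB_deg xs \<mm> r (t - 1)) (ddiff xs l) i X =
      homology_zero (mB_deg xs \<mm> r (t - 1)) (ddiff xs l) i"
proof
  let ?C = "mB_deg xs \<mm> r t" and ?D = "mB_deg xs \<mm> r (t - 1)" and ?d = "ddiff xs l"
  fix X assume "X \<in> homology ?C ?d i"
  then obtain x where x: "x \<in> cycles_deg ?C ?d i" and X: "X = homologous ?C ?d i `` {x}"
    unfolding homology_def by (rule quotientE)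
  have d_diff: "?d u - ?d v \<in> ?d ` ?D j" if "u \<in> ?D j" "v \<in> ?D j" for u v j
    using diff_in_mB_deg[OF that] by (metis additive.diff[OF additive_ddiff] imageI)
  have d0: "?d 0 = 0" by (rule additive.zero[OF additive_ddiff])
  have CD: "?C j \<subseteq> ?D j" for j
    using ideal_power_Suc_subset[of \<mm> "t - 1"] assms(3)
    by (fastforce simp: mB_deg_iff kcoeffs_def)
  \<comment> \<open>Since \<open>z\<close> bounds in \<open>?D\<close>, being homologous to
    \<open>z\<close> there is the same as being homologous to 0.\<close>
  have null: "homologous ?D ?d i `` {z} = homology_zero ?D ?d i" if z: "z \<in> cycles_deg ?C ?d i" for z
  proof -
    obtain u where u: "u \<in> ?D (Suc i)" "z = ?d u"
      \<comment> \<open>Inserting 0 keeps \<open>Max\<close> meaningful for empty support, and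
        \<open>Suc\<close> turns the maximum into a strict bound.\<close>
      using cycle_is_boundary[OF assms(1,2) _ assms(5,6), of z i "Suc (Max (insert 0 (supp z)))"] z assms(3)
      by (fastforce simp: cycles_deg_def less_Suc_eq_le)
    have "z - y \<in> ?d ` ?D (Suc i) \<longleftrightarrow> 0 - y \<in> ?d ` ?D (Suc i)" for y
    proof
      assume "z - y \<in> ?d ` ?D (Suc i)"
      then obtain v where v: "v \<in> ?D (Suc i)" "z - y = ?d v" by auto
      then have "0 - y = ?d v - ?d u" using u by (simp add: algebra_simps)
      then show "0 - y \<in> ?d ` ?D (Suc i)" using d_diff[OF v(1) u(1)] by simp
    next
      assume "0 - y \<in> ?d ` ?D (Suc i)"
      then obtain v where v: "v \<in> ?D (Suc i)" "0 - y = ?d v" by auto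
      then have "z - y = ?d v - ?d (0 - u)"
        using u by (simp add: additive.minus[OF additive_ddiff] flip: v(2))
      then show "z - y \<in> ?d ` ?D (Suc i)" using d_diff[OF v(1) diff_in_mB_deg[OF zero_in_mB_deg u(1)]] by simp
    qed
    moreover have "z \<in> cycles_deg ?D ?d i" "0 \<in> cycles_deg ?D ?d i"
      using z CD zero_in_mB_deg d0 by (auto simp: cycles_deg_def)
    ultimately show ?thesis by (auto simp: homology_zero_def homologous_def)
  qed
  \<comment> \<open>The class \<open>X\<close> contains \<open>x\<close>, so the union defining
    \<open>homology_map\<close> is nonempty; all its members equal the zero class.\<close>
  have "x - x \<in> ?d ` ?C (Suc i)"
    using d0 zero_in_mB_deg by (metis diff_self imageI)
  then have "x \<in> X" using x by (simp add: X homologous_def)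
  moreover have "X \<subseteq> cycles_deg ?C ?d i" by (auto simp: X homologous_def)
  ultimately show "homology_map (\<lambda>w. w) ?D ?d i X = homology_zero ?D ?d i"
    unfolding homology_map_def using null by blast
qed

end
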